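(* Let $T=V_1-V_2$, where $V_1\sim\chi_r'^2(\lambda_1)$ and $V_2\sim\chi_r'^2(\lambda_2)$ are independent, with $r>0$ (real) and $\lambda_1,\lambda_2\geq0$. Then, for integers $k\geq1$, $$\mathbb{E}[T^k]=\frac{2^k\mathrm{e}^{-(\lambda_1+\lambda_2)/2}}{(\Gamma(r/2))^2}\sum_{j=0}^k(-1)^{k-j}\binom{k}{j}\Gamma\bigg(j+\frac{r}{2}\bigg)\Gamma\bigg(k-j+\frac{r}{2}\bigg) M\bigg(j+\frac{r}{2},\frac{r}{2},\frac{\lambda_1}{2}\bigg)M\bigg(k-j+\frac{r}{2},\frac{r}{2},\frac{\lambda_2}{2}\bigg).$$ In particular, the first four raw moments $\mu_k'=\mathbb{E}[T^k]$ are \begin{align*} \mu_1'&=\lambda_1-\lambda_2, \\ \mu_2'&=4(r+\lambda_1+\lambda_2)+(\lambda_1-\lambda_2)^2,\\ \mu_3'&=12(\lambda_1-\lambda_2)(r+\lambda_1+\lambda_2+2)+(\lambda_1-\lambda_2)^3,\\ \mu_4'&=48(r+\lambda_1+\lambda_2)^2+96(r+2\lambda_1+2\lambda_2)+24(\lambda_1-\lambda_2)^2(r+\lambda_1+\lambda_2+4)+(\lambda_1-\lambda_2)^4, \end{align*} and the central moments $\mu_k=\mathbb{E}[(T-\mathbb{E}[T])^k]$ are \begin{align*} \mu_2&=4(r+\lambda_1+\lambda_2), \\ \mu_3&=24(\lambda_1-\lambda_2),\\ \mu_4&=48(r+\lambda_1+\lambda_2)^2+96(r+2\lambda_1+2\lambda_2).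 \end{align*} The variance $\sigma^2$, skewness $\gamma_1=\mu_3/\sigma^{3}$ and excess kurtosis $\gamma_2=\mu_4/\sigma^4-3$ of $T$ are given by $$\sigma^2=4(r+\lambda_1+\lambda_2),\quad \gamma_1=\frac{3(\lambda_1-\lambda_2)}{(r+\lambda_1+\lambda_2)^{3/2}},\quad\gamma_2=\frac{6(r+2\lambda_1+2\lambda_2)}{(r+\lambda_1+\lambda_2)^2}.$$ The cumulants of $T$ are given by $$\kappa_k=2^{k-1}(k-1)!\,[(r+k\lambda_1)+(-1)^k(r+k\lambda_2)], \quad k\geq1.$$
   Context: For real $r>0$, the noncentral chi-square distribution $\chi_r'^2(\lambda)$ with $r$ degrees of freedom and noncentrality parameter $\lambda>0$ has density $p(x)=\frac{1}{2}\mathrm{e}^{-(x+\lambda)/2}(x/\lambda)^{r/4-1/2}I_{r/2-1}(\sqrt{\lambda x})$, $x\geq0$, where $I_\nu$ is the modified Bessel function of the first kind; $\chi_r'^2(0)$ is the chi-square distribution with $r$ degrees of freedom. (For integer $r$, $\chi_r'^2(\lambda)$ is the law of $\sum_{i=1}^rX_i^2$ with $X_i\sim N(\mu_i,1)$ independent and $\lambda=\sum_{i=1}^r\mu_i^2$.) $M(a,b,x)={}_1F_1(a,b,x)$ is the confluent hypergeometric function of the first kind (Kummer's function). *)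

theory Defs
  imports "HOL-Probability.Probability"
begin

text \<open>Only the values for \<open>x > 0\<close> are meaningful: as \<open>0 powr a = 0\<close> for every \<open>a\<close>, the value at \<open>x = 0\<close> is not
  the limit when \<open>\<nu> \<le> 0\<close>.\<close>

definition bessel_I :: "real \<Rightarrow> real \<Rightarrow> real" where
  "bessel_I \<nu> x =
     (x / 2) powr \<nu> * (\<Sum>m. (x / 2) ^ (2 * m) / (fact m * Gamma (real m + \<nu> + 1)))"

definition kummer_M :: "real \<Rightarrow> real \<Rightarrow> real \<Rightarrow> real" where
  "kummer_M a b x = eval_fps (fps_hypergeo [a] [b] 1) x"

text \<open>At the single point \<open>x = 0\<close>, where the textbook formulas may have a pole or a nonzero limit,
  both branches take the value \<open>0\<close>; this does not affect the law.\<close>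

definition noncentral_chi_square_density :: "real \<Rightarrow> real \<Rightarrow> real \<Rightarrow> real" where
  "noncentral_chi_square_density r l x =
     (if x < 0 then 0
      else if l = 0 then x powr (r / 2 - 1) * exp (- x / 2) / (2 powr (r / 2) * Gamma (r / 2))
      else 1 / 2 * exp (- (x + l) / 2) * (x / l) powr (r / 4 - 1 / 2)
             * bessel_I (r / 2 - 1) (sqrt (l * x)))"

definition raw_moment :: "'a measure \<Rightarrow> ('a \<Rightarrow> real) \<Rightarrow> nat \<Rightarrow> real" where
  "raw_moment M X k = integral\<^sup>L M (\<lambda>\<omega>. X \<omega> ^ k)"

definition central_moment :: "'a measure \<Rightarrow> ('a \<Rightarrow> real) \<Rightarrow> nat \<Rightarrow> real" where
  "central_moment M X k = integral\<^sup>L M (\<lambda>\<omega>. (X \<omega> - integral\<^sup>L M X) ^ k)"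

definition skewness :: "'a measure \<Rightarrow> ('a \<Rightarrow> real) \<Rightarrow> real" where
  "skewness M X = central_moment M X 3 / sqrt (prob_space.variance M X) ^ 3"

definition excess_kurtosis :: "'a measure \<Rightarrow> ('a \<Rightarrow> real) \<Rightarrow> real" where
  "excess_kurtosis M X = central_moment M X 4 / sqrt (prob_space.variance M X) ^ 4 - 3"

text \<open>Meaningful when the moment generating function is finite in a neighbourhood of \<open>0\<close>.\<close>

definition cumulant :: "'a measure \<Rightarrow> ('a \<Rightarrow> real) \<Rightarrow> nat \<Rightarrow> real" where
  "cumulant M X k = (deriv ^^ k) (\<lambda>t. ln (integral\<^sup>L M (\<lambda>\<omega>. exp (t * X \<omega>)))) 0"

end

theory Submission
  imports Defs
begin

text \<open>
  The Bessel series turns the noncentral chi-square density into a mixture: with \<open>N\<close> Poisson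
  distributed with mean \<open>\<lambda>/2\<close>, a variable \<open>V\<close> of this law is, given \<open>N = m\<close>, Gamma
  distributed with shape \<open>r/2 + m\<close> and rate \<open>1/2\<close>. All terms are nonnegative, so integrating
  \<open>x\<^sup>p e\<^bsup>tx\<^esup>\<close> term by term is legitimate for every \<open>p\<close> and every \<open>t < 1/2\<close>
  (\<open>has_bochner_integral_noncentral_chi_square\<close>). The two special cases \<open>t = 0\<close> and
  \<open>p = 0\<close> are what is needed.

  For \<open>t = 0\<close> the result is \<open>E(V\<^sup>k) = 2\<^sup>k E((r/2 + N)\<^sub>k)\<close>, where \<open>(b)\<^sub>k\<close> is the rising factorial.
  The Poisson mean of \<open>(b + N)\<^sub>k\<close> satisfies a two-term recursion in \<open>k\<close>
  (\<open>poisson_rising_moment_sums\<close>), and up to Gamma factors it is also Kummer's series, because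
  \<open>(b + k)\<^sub>m / (b)\<^sub>m = (b + m)\<^sub>k / (b)\<^sub>k\<close>
  (\<open>Gamma_kummer_M_conv_poisson_rising_moment\<close>). So the binomial expansion of \<open>(V\<^sub>1 - V\<^sub>2)\<^sup>k\<close>
  and independence give the general moment formula, and the recursion makes the moments
  for small \<open>k\<close> explicit polynomials, from which the central moments, skewness and kurtosis follow.

  For \<open>p = 0\<close> the Poisson sum is an exponential series, which gives the moment generating function
  \<open>(1 - 2t)\<^bsup>-r/2\<^esup> exp (\<lambda>t / (1 - 2t))\<close>. Its logarithm can be differentiated \<open>k\<close> times in closed
  form, and the cumulants are the values at \<open>0\<close> of the derivatives of
  \<open>K\<^sub>1(t) + K\<^sub>2(-t)\<close>, where \<open>K\<^sub>i\<close> is the logarithm for \<open>V\<^sub>i\<close>.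
\<close>

section \<open>The density as a Poisson mixture of Gamma densities\<close>

lemma nn_integral_gamma_kernel:
  fixes a c :: real
  assumes a: "a > 0" and c: "c > 0"
  shows "(\<integral>\<^sup>+x. ennreal (indicator {0..} x * x powr (a - 1) * exp (- c * x)) \<partial>lborel)
           = ennreal (Gamma a / c powr a)"
proof -
  have "(\<integral>\<^sup>+x. ennreal (indicator {0..} x * x powr (a - 1) * exp (- c * x)) \<partial>lborel)
      = \<bar>1 / c\<bar> * (\<integral>\<^sup>+x. ennreal (indicator {0..} (0 + 1 / c * x) * (0 + 1 / c * x) powr (a - 1)
          * exp (- c * (0 + 1 / c * x))) \<partial>lborel)"
    using c by (intro nn_integral_real_affine) auto
  also have "\<dots> = ennreal (1 / c) * (\<integral>\<^sup>+x. ennreal (c powr (1 - a)) *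
        ennreal (indicator {0..} x * x powr (a - 1) / exp x) \<partial>lborel)"
  proof -
    have "ennreal (indicator {0..} (0 + 1 / c * x) * (0 + 1 / c * x) powr (a - 1)
          * exp (- c * (0 + 1 / c * x)))
        = ennreal (c powr (1 - a)) * ennreal (indicator {0..} x * x powr (a - 1) / exp x)" for x
    proof (cases "x \<ge> 0")
      case True
      have "(x / c) powr (a - 1) = c powr (1 - a) * x powr (a - 1)"
        using True c by (simp add: powr_divide powr_diff)
      then show ?thesis
        using True c by (simp add: ennreal_mult'[symmetric] exp_minus field_simps)
    next
      case False
      then have "\<not> 0 \<le> x / c" using c by (simp add: field_simps)
      with False show ?thesis by simp
    qed
    then show ?thesis using c by simp
  qed
  also have "\<dots> = ennreal (1 / c) * (ennreal (c powr (1 - a)) * ennreal (Gamma a))"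
    by (subst nn_integral_cmult) (simp_all add: Gamma_conv_nn_integral_real[OF a])
  also have "\<dots> = ennreal (Gamma a / c powr a)"
    using a c by (simp add: ennreal_mult'[symmetric] powr_diff Gamma_real_nonneg)
  finally show ?thesis .
qed

text \<open>The Poisson probability of \<open>m\<close> with mean \<open>x\<close>, times the factor \<open>1 / (2\<^bsup>b+m\<^esup> \<Gamma>(b + m))\<close>
  that normalises the Gamma density with shape \<open>b + m\<close> and rate \<open>1/2\<close>.\<close>

definition gamma_mixture_weight :: "real \<Rightarrow> real \<Rightarrow> nat \<Rightarrow> real" where
  "gamma_mixture_weight b x m
     = exp (- x) * x ^ m / fact m / (2 powr (b + real m) * Gamma (b + real m))"

lemma gamma_mixture_weight_nonneg:
  "b > 0 \<Longrightarrow> x \<ge> 0 \<Longrightarrow> gamma_mixture_weight b x m \<ge> 0"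
  by (auto simp: gamma_mixture_weight_def intro!: divide_nonneg_nonneg mult_nonneg_nonneg)

text \<open>A lower bound uniform in \<open>m\<close>, so that the Bessel series is dominated by the exponential
  series; for \<open>m > 0\<close> the factor \<open>b\<close> is the only one that can be below \<open>1\<close>.\<close>

lemma pochhammer_lower_bound:
  fixes b :: real
  assumes "b > 0"
  shows "pochhammer b m \<ge> min 1 b"
proof (cases m)
  case (Suc n)
  have "pochhammer (b + 1) n \<ge> 1"
    unfolding pochhammer_prod using assms by (intro prod_ge_1) auto
  then have "b * pochhammer (b + 1) n \<ge> b"
    using assms by simp
  then show ?thesis by (simp add: Suc pochhammer_rec)
qed simp

lemma summable_bessel_series:
  fixes b y :: real
  assumes "b > 0"
  shows "summable (\<lambda>m. y ^ m / (fact m * Gamma (real m + b)))"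
proof (rule summable_comparison_test)
  define C where "C = min 1 b * Gamma b"
  have C: "C > 0" using assms by (simp add: C_def)
  have "Gamma (real m + b) \<ge> C" for m
  proof -
    have "pochhammer b m = Gamma (b + real m) / Gamma b"
      using assms by (intro pochhammer_Gamma) auto
    then have "Gamma (real m + b) = pochhammer b m * Gamma b"
      using Gamma_real_pos[OF assms] by (simp add: add.commute field_simps)
    then show ?thesis
      using pochhammer_lower_bound[OF assms, of m] Gamma_real_pos[OF assms]
      by (simp add: C_def mult_right_mono)
  qed
  then have "norm (y ^ m / (fact m * Gamma (real m + b))) \<le> \<bar>y\<bar> ^ m /\<^sub>R fact m / C" for m
  proof -
    have "Gamma (real m + b) \<ge> C" by fact
    then have "\<bar>y\<bar> ^ m / (fact m * Gamma (real m + b)) \<le> \<bar>y\<bar> ^ m / (fact m * C)"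
      using C by (intro divide_left_mono mult_left_mono mult_pos_pos) auto
    then show ?thesis using assms
      by (simp add: abs_mult power_abs Gamma_real_nonneg add_nonneg_pos scaleR_conv_of_real field_simps)
  qed
  then show "\<exists>N. \<forall>m\<ge>N. norm (y ^ m / (fact m * Gamma (real m + b))) \<le> \<bar>y\<bar> ^ m /\<^sub>R fact m / C"
    by blast
  show "summable (\<lambda>m. \<bar>y\<bar> ^ m /\<^sub>R fact m / C)"
    by (intro summable_divide summable_exp_generic)
qed

text \<open>The powers of \<open>x\<close> and \<open>l\<close> in front of the Bessel function cancel the leading power
  \<open>(\<surd>(l x) / 2)\<^bsup>r/2-1\<^esup>\<close> of its series up to \<open>x\<^bsup>r/2-1\<^esup>\<close> and a power of \<open>2\<close>. For \<open>l = 0\<close> only the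
  weight at \<open>m = 0\<close> survives, since \<open>0 ^ 0 = 1\<close>, so the mixture also covers the central case.\<close>

lemma noncentral_chi_square_density_gamma_mixture:
  fixes r l x :: real
  assumes r: "r > 0" and l: "l \<ge> 0" and x: "x > 0"
  shows "(\<lambda>m. gamma_mixture_weight (r / 2) (l / 2) m * x powr (r / 2 + real m - 1) * exp (- x / 2))
           sums noncentral_chi_square_density r l x"
proof (cases "l = 0")
  case True
  have "(\<lambda>m. gamma_mixture_weight (r / 2) 0 m * x powr (r / 2 + real m - 1) * exp (- x / 2))
      sums (\<Sum>m\<in>{0}. gamma_mixture_weight (r / 2) 0 m * x powr (r / 2 + real m - 1) * exp (- x / 2))"
    by (rule sums_finite) (auto simp: gamma_mixture_weight_def)
  then show ?thesis using True x
    by (simp add: gamma_mixture_weight_def noncentral_chi_square_density_def)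
next
  case False
  with l have l: "l > 0" by simp
  define b where "b = r / 2"
  have b: "b > 0" using r by (simp add: b_def)
  define K where "K = 1 / 2 * exp (- (x + l) / 2) * (x / l) powr (r / 4 - 1 / 2)
      * (sqrt (l * x) / 2) powr (b - 1)"
  have "(\<lambda>m. (l * x / 4) ^ m / (fact m * Gamma (real m + b)))
      sums (\<Sum>m. (l * x / 4) ^ m / (fact m * Gamma (real m + b)))"
    by (intro summable_sums summable_bessel_series b)
  then have "(\<lambda>m. K * ((l * x / 4) ^ m / (fact m * Gamma (real m + b))))
      sums (K * (\<Sum>m. (l * x / 4) ^ m / (fact m * Gamma (real m + b))))"
    by (rule sums_mult)
  also have "K * (\<Sum>m. (l * x / 4) ^ m / (fact m * Gamma (real m + b)))
      = noncentral_chi_square_density r l x"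
  proof -
    have "(sqrt (l * x) / 2) ^ (2 * m) = (l * x / 4) ^ m" for m
      using l x by (simp add: power_mult power_divide)
    then show ?thesis using l x
      by (simp add: noncentral_chi_square_density_def bessel_I_def K_def b_def mult_ac)
  qed
  also have "(\<lambda>m. K * ((l * x / 4) ^ m / (fact m * Gamma (real m + b))))
      = (\<lambda>m. gamma_mixture_weight (r / 2) (l / 2) m * x powr (r / 2 + real m - 1) * exp (- x / 2))"
  proof
    fix m
    have "(x / l) powr (r / 4 - 1 / 2) * (sqrt (l * x) / 2) powr (b - 1) = x powr (b - 1) * 2 powr (1 - b)"
    proof -
      have "(x / l) powr (r / 4 - 1 / 2) * (sqrt (l * x) / 2) powr (b - 1)
        = exp ((b - 1) * ln x + (1 - b) * ln 2)"
        using l x by (simp add: powr_def ln_div ln_mult ln_sqrt exp_add[symmetric] b_def field_simps)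
      also have "\<dots> = x powr (b - 1) * 2 powr (1 - b)"
        using x by (simp add: powr_def exp_add)
      finally show ?thesis .
    qed
    then have K: "K = 1 / 2 * exp (- l / 2) * exp (- x / 2) * (x powr (b - 1) * 2 powr (1 - b))"
      by (simp add: K_def mult.assoc exp_add[symmetric] field_simps)
    have p: "x powr (b + real m - 1) = x powr (b - 1) * x ^ m"
      using x by (simp add: powr_add powr_diff powr_realpow)
    have q: "2 powr (b + real m) = 2 / 2 powr (1 - b) * (2::real) ^ m"
      by (simp add: powr_add powr_diff powr_realpow)
    have f: "(4::real) ^ m = 2 ^ m * 2 ^ m"
      by (simp add: power_mult_distrib[symmetric])
    show "K * ((l * x / 4) ^ m / (fact m * Gamma (real m + b))) =
        gamma_mixture_weight (r / 2) (l / 2) m * x powr (r / 2 + real m - 1) * exp (- x / 2)"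
      unfolding b_def[symmetric] gamma_mixture_weight_def K p q
      by (simp add: f power_divide power_mult_distrib mult_ac add.commute)
  qed
  finally show ?thesis .
qed

lemma noncentral_chi_square_density_nonneg:
  assumes "r > 0" "l \<ge> 0"
  shows "noncentral_chi_square_density r l x \<ge> 0"
proof (cases "x > 0")
  case True
  show ?thesis
    by (rule sums_le[OF _ sums_zero noncentral_chi_square_density_gamma_mixture[OF assms True]])
       (use assms in \<open>auto intro!: mult_nonneg_nonneg gamma_mixture_weight_nonneg\<close>)
next
  case False
  then show ?thesis
    by (cases "x = 0") (auto simp: noncentral_chi_square_density_def bessel_I_def)
qed

text \<open>On the support the integrand is nonnegative, so monotone convergence allows termwise
  integration of the mixture; the factor \<open>x\<^sup>p e\<^bsup>tx\<^esup>\<close> changes the shape of the \<open>m\<close>-th Gamma kernel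
  to \<open>r/2 + m + p\<close> and its rate to \<open>1/2 - t\<close>. The value is left as a series so that one lemma serves
  both the moments and the moment generating function.\<close>

lemma has_bochner_integral_noncentral_chi_square:
  fixes r l t S :: real and p :: nat
  assumes r: "r > 0" and l: "l \<ge> 0" and t: "t < 1 / 2"
    and meas[measurable]: "noncentral_chi_square_density r l \<in> borel_measurable borel"
    and S: "(\<lambda>m. exp (- l / 2) * (l / 2) ^ m / fact m * pochhammer (r / 2 + real m) p * 2 ^ p
              * (1 - 2 * t) powr (- (r / 2 + real m + real p))) sums S"
  shows "has_bochner_integral lborel
           (\<lambda>x. noncentral_chi_square_density r l x * (x ^ p * exp (t * x))) S"
proof (rule has_bochner_integral_nn_integral)
  define b where "b = r / 2"
  have b: "b > 0" using r by (simp add: b_def)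
  define w where "w = gamma_mixture_weight b (l / 2)"
  have w: "w m \<ge> 0" for m using b l by (simp add: w_def gamma_mixture_weight_nonneg)
  define k where
    "k = (\<lambda>m x. indicator {0..} x * x powr ((b + real m + real p) - 1) * exp (- (1 / 2 - t) * x))"
  have k: "k m x \<ge> 0" for m x by (simp add: k_def)
  have km[measurable]: "k m \<in> borel_measurable borel" for m unfolding k_def by measurable
  \<comment> \<open>At \<open>x = 0\<close> the density takes a conventional value, which a null set hides.\<close>
  have 1: "ennreal (noncentral_chi_square_density r l x * (x ^ p * exp (t * x)))
      = (\<Sum>m. ennreal (w m * k m x))" if x: "x \<noteq> 0" for x
  proof (cases "x > 0")
    case True
    have "(\<lambda>m. w m * x powr (b + real m - 1) * exp (- x / 2) * (x ^ p * exp (t * x)))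
        sums (noncentral_chi_square_density r l x * (x ^ p * exp (t * x)))"
      using noncentral_chi_square_density_gamma_mixture[OF r l True]
      unfolding w_def b_def by (intro sums_mult2)
    also have "(\<lambda>m. w m * x powr (b + real m - 1) * exp (- x / 2) * (x ^ p * exp (t * x)))
        = (\<lambda>m. w m * k m x)"
    proof
      fix m
      have "x powr (b + real m + real p - 1) = x powr (b + real m - 1) * x ^ p"
        using True by (simp add: powr_realpow[symmetric] powr_add[symmetric] algebra_simps)
      moreover have "exp (- (1 / 2 - t) * x) = exp (- x / 2) * exp (t * x)"
        by (simp add: exp_add[symmetric] algebra_simps)
      ultimately show "w m * x powr (b + real m - 1) * exp (- x / 2) * (x ^ p * exp (t * x)) = w m * k m x"
        using True by (simp add: k_def)
    qed
    finally show ?thesis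
      using w k by (intro suminf_ennreal_eq[symmetric]) auto
  next
    case False
    with x have "x < 0" by simp
    then show ?thesis by (simp add: noncentral_chi_square_density_def k_def)
  qed
  have "(\<integral>\<^sup>+x. ennreal (noncentral_chi_square_density r l x * (x ^ p * exp (t * x))) \<partial>lborel)
      = (\<integral>\<^sup>+x. (\<Sum>m. ennreal (w m * k m x)) \<partial>lborel)"
    using AE_lborel_singleton[of "0::real"] by (intro nn_integral_cong_AE) (auto elim!: eventually_mono simp: 1)
  also have "\<dots> = (\<Sum>m. \<integral>\<^sup>+x. ennreal (w m * k m x) \<partial>lborel)"
    by (intro nn_integral_suminf) measurable
  also have "\<dots> = (\<Sum>m. ennreal (exp (- l / 2) * (l / 2) ^ m / fact m * pochhammer (r / 2 + real m) p
      * 2 ^ p * (1 - 2 * t) powr (- (r / 2 + real m + real p))))"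
  proof (rule suminf_cong)
    fix m
    have "(\<integral>\<^sup>+x. ennreal (w m * k m x) \<partial>lborel) = ennreal (w m) * (\<integral>\<^sup>+x. ennreal (k m x) \<partial>lborel)"
      using w k by (subst nn_integral_cmult[symmetric]) (auto simp: ennreal_mult')
    also have "(\<integral>\<^sup>+x. ennreal (k m x) \<partial>lborel)
        = ennreal (Gamma (b + real m + real p) / (1 / 2 - t) powr (b + real m + real p))"
      unfolding k_def using b t by (intro nn_integral_gamma_kernel) auto
    also have "ennreal (w m) * \<dots> = ennreal (w m * (Gamma (b + real m + real p) / (1 / 2 - t) powr (b + real m + real p)))"
      using w by (intro ennreal_mult'[symmetric]) auto
    also have "w m * (Gamma (b + real m + real p) / (1 / 2 - t) powr (b + real m + real p))
      = exp (- l / 2) * (l / 2) ^ m / fact m * pochhammer (b + real m) p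
      * 2 ^ p * (1 - 2 * t) powr (- (b + real m + real p))"
    proof -
      have poch: "pochhammer (b + real m) p = Gamma (b + real m + real p) / Gamma (b + real m)"
        using b by (intro pochhammer_Gamma) auto
      have half: "(1 / 2 - t) powr (b + real m + real p)
          = (1 - 2 * t) powr (b + real m + real p) / (2 powr (b + real m) * 2 ^ p)"
      proof -
        have "(1 / 2 - t) = (1 - 2 * t) / 2" by (simp add: field_simps)
        then have "(1 / 2 - t) powr (b + real m + real p)
          = (1 - 2 * t) powr (b + real m + real p) / 2 powr (b + real m + real p)"
          using t by (simp only: powr_divide)
        then show ?thesis by (simp add: powr_add powr_realpow)
      qed
      have cancel: "e / (A * G) * (H / (R / (A * q))) = e * (H / G) * q * inverse R"
        if "A \<noteq> 0" for e A G H R q :: real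
        using that by (simp add: field_simps)
      show ?thesis
        unfolding w_def gamma_mixture_weight_def poch half powr_minus
        by (subst cancel) (simp, simp only: divide_inverse minus_mult_left)
    qed
    finally show "(\<integral>\<^sup>+x. ennreal (w m * k m x) \<partial>lborel)
      = ennreal (exp (- l / 2) * (l / 2) ^ m / fact m * pochhammer (r / 2 + real m) p
      * 2 ^ p * (1 - 2 * t) powr (- (r / 2 + real m + real p)))"
      unfolding b_def .
  qed
  also have "\<dots> = ennreal S"
    using r l by (intro suminf_ennreal_eq[OF _ S] mult_nonneg_nonneg divide_nonneg_nonneg pochhammer_nonneg) auto
  finally show "(\<integral>\<^sup>+x. ennreal (noncentral_chi_square_density r l x * (x ^ p * exp (t * x))) \<partial>lborel)
      = ennreal S" .
  show "S \<ge> 0"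
    by (rule sums_le[OF _ sums_zero S]) (use r l in \<open>auto intro!: mult_nonneg_nonneg divide_nonneg_nonneg pochhammer_nonneg\<close>)
  show "AE x in lborel. 0 \<le> noncentral_chi_square_density r l x * (x ^ p * exp (t * x))"
  proof (rule AE_I2)
    fix x :: real
    show "0 \<le> noncentral_chi_square_density r l x * (x ^ p * exp (t * x))"
      using noncentral_chi_square_density_nonneg[OF r l, of x]
      by (cases "x < 0") (auto simp: noncentral_chi_square_density_def)
  qed
qed (use meas in measurable)

section \<open>Rising factorial moments of the Poisson distribution and Kummer's function\<close>

text \<open>For \<open>N\<close> Poisson distributed with mean \<open>x\<close>, this is the expectation of the rising factorial
  \<open>(b + N) (b + N + 1) \<dots> (b + N + k - 1)\<close>, in a form that evaluates to a polynomial for each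
  numeral \<open>k\<close>.\<close>

fun poisson_rising_moment :: "nat \<Rightarrow> real \<Rightarrow> real \<Rightarrow> real" where
  "poisson_rising_moment 0 b x = 1"
| "poisson_rising_moment (Suc k) b x
     = b * poisson_rising_moment k (b + 1) x + x * poisson_rising_moment k (b + 2) x"

text \<open>Split \<open>(b + m)\<^sub>k\<^sub>+\<^sub>1 = b (b + 1 + m)\<^sub>k + m (b + 1 + m)\<^sub>k\<close>; in the second part the factor
  \<open>m\<close> turns \<open>x\<^sup>m / m!\<close> into \<open>x \<cdot> x\<^bsup>m-1\<^esup> / (m-1)!\<close>, and shifting the index by one raises \<open>b + 1\<close>
  to \<open>b + 2\<close>.\<close>

lemma poisson_rising_moment_sums:
  "(\<lambda>m. x ^ m / fact m * pochhammer (b + real m) k) sums (exp x * poisson_rising_moment k b x)"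
proof (induction k arbitrary: b)
  case 0
  show ?case using exp_converges[of x] by (simp add: divide_inverse mult.commute)
next
  case (Suc k)
  define g where "g = (\<lambda>m. x ^ m / fact m * (real m * pochhammer (b + 1 + real m) k))"
  have "(\<lambda>m. g (Suc m)) = (\<lambda>m. x * (x ^ m / fact m * pochhammer (b + 2 + real m) k))"
  proof
    fix m
    have "x ^ Suc m / fact (Suc m) * real (Suc m) = x * (x ^ m / fact m)"
      by (simp add: field_simps del: of_nat_Suc)
    moreover have "b + 1 + real (Suc m) = b + 2 + real m" by simp
    moreover have "g (Suc m) = x ^ Suc m / fact (Suc m) * real (Suc m) * pochhammer (b + 1 + real (Suc m)) k"
      unfolding g_def by (simp only: mult.assoc)
    ultimately show "g (Suc m) = x * (x ^ m / fact m * pochhammer (b + 2 + real m) k)"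
      by (simp only: mult.assoc)
  qed
  then have "(\<lambda>m. g (Suc m)) sums (x * (exp x * poisson_rising_moment k (b + 2) x))"
    using sums_mult[OF Suc.IH[of "b + 2"]] by simp
  then have g: "g sums (x * (exp x * poisson_rising_moment k (b + 2) x))"
    by (subst (asm) sums_Suc_iff) (simp add: g_def)
  have "(\<lambda>m. b * (x ^ m / fact m * pochhammer (b + 1 + real m) k) + g m)
      sums (b * (exp x * poisson_rising_moment k (b + 1) x) + x * (exp x * poisson_rising_moment k (b + 2) x))"
    by (intro sums_add sums_mult Suc.IH g)
  then show ?case
    by (simp add: g_def pochhammer_rec algebra_simps)
qed

text \<open>The two series agree term by term, because both
  \<open>\<Gamma>(b + k) (b + k)\<^sub>m\<close> and \<open>\<Gamma>(b) (b)\<^sub>m (b + m)\<^sub>k\<close> equal \<open>\<Gamma>(b + k + m)\<close>.\<close>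

lemma Gamma_kummer_M_conv_poisson_rising_moment:
  fixes b x :: real
  assumes b: "b > 0"
  shows "Gamma (real k + b) * kummer_M (real k + b) b x = Gamma b * exp x * poisson_rising_moment k b x"
proof -
  have eq: "Gamma (real k + b) * (fps_nth (fps_hypergeo [real k + b] [b] 1) m * x ^ m)
      = Gamma b * (x ^ m / fact m * pochhammer (b + real m) k)" for m
  proof -
    have "pochhammer (real k + b) m = Gamma (real k + b + real m) / Gamma (real k + b)"
         "pochhammer b m = Gamma (b + real m) / Gamma b"
         "pochhammer (b + real m) k = Gamma (b + real m + real k) / Gamma (b + real m)"
      using b by (auto intro!: pochhammer_Gamma)
    moreover have "Gamma (real k + b) > 0" "Gamma (b + real m) > 0" "Gamma b > 0" "pochhammer b m > 0"
      using b by (auto intro: Gamma_real_pos pochhammer_pos)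
    moreover have "real k + b + real m = b + real m + real k" by simp
    ultimately have "Gamma (real k + b) * pochhammer (real k + b) m
        = Gamma b * pochhammer b m * pochhammer (b + real m) k"
      by simp
    then show ?thesis
      using \<open>pochhammer b m > 0\<close> by (simp add: field_simps)
  qed
  have sums: "(\<lambda>m. Gamma (real k + b) * (fps_nth (fps_hypergeo [real k + b] [b] 1) m * x ^ m))
      sums (Gamma b * (exp x * poisson_rising_moment k b x))"
    unfolding eq by (intro sums_mult poisson_rising_moment_sums)
  have G: "Gamma (real k + b) \<noteq> 0" using b Gamma_real_pos[of "real k + b"] by linarith
  from sums_mult_D[OF sums this]
  have "(\<lambda>m. fps_nth (fps_hypergeo [real k + b] [b] 1) m * x ^ m)
      sums (Gamma b * (exp x * poisson_rising_moment k b x) / Gamma (real k + b))"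
    .
  then show ?thesis
    unfolding kummer_M_def eval_fps_def using G by (simp add: sums_iff)
qed


section \<open>Moments and moment generating function of the noncentral chi-square law\<close>

lemma distributed_noncentral_chi_square_has_bochner_integral:
  fixes V :: "'a \<Rightarrow> real"
  assumes V: "distributed M lborel V (\<lambda>x. ennreal (noncentral_chi_square_density r l x))"
    and r: "r > 0" and l: "l \<ge> 0" and t: "t < 1 / 2"
    and S: "(\<lambda>m. exp (- l / 2) * (l / 2) ^ m / fact m * pochhammer (r / 2 + real m) p * 2 ^ p
              * (1 - 2 * t) powr (- (r / 2 + real m + real p))) sums S"
  shows "has_bochner_integral M (\<lambda>\<omega>. V \<omega> ^ p * exp (t * V \<omega>)) S"
proof -
  have nn: "noncentral_chi_square_density r l x \<ge> 0" for x
    using r l by (rule noncentral_chi_square_density_nonneg)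
  have "(\<lambda>x. enn2real (ennreal (noncentral_chi_square_density r l x))) \<in> borel_measurable borel"
    using distributed_borel_measurable[OF V] by simp
  then have "noncentral_chi_square_density r l \<in> borel_measurable borel"
    using nn by simp
  note * = has_bochner_integral_noncentral_chi_square[OF r l t this S]
  have "integrable M (\<lambda>\<omega>. V \<omega> ^ p * exp (t * V \<omega>))"
    using * nn by (subst distributed_integrable[OF V, symmetric]) (auto simp: has_bochner_integral_iff)
  moreover have "integral\<^sup>L M (\<lambda>\<omega>. V \<omega> ^ p * exp (t * V \<omega>)) = S"
    using * nn by (subst distributed_integral[OF V, symmetric]) (auto simp: has_bochner_integral_iff)
  ultimately show ?thesis by (simp add: has_bochner_integral_iff)
qed

lemma noncentral_chi_square_moment:
  fixes V :: "'a \<Rightarrow> real"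
  assumes V: "distributed M lborel V (\<lambda>x. ennreal (noncentral_chi_square_density r l x))"
    and r: "r > 0" and l: "l \<ge> 0"
  shows "has_bochner_integral M (\<lambda>\<omega>. V \<omega> ^ k) (2 ^ k * poisson_rising_moment k (r / 2) (l / 2))"
proof -
  have "(\<lambda>m. exp (- l / 2) * 2 ^ k * ((l / 2) ^ m / fact m * pochhammer (r / 2 + real m) k))
      sums (exp (- l / 2) * 2 ^ k * (exp (l / 2) * poisson_rising_moment k (r / 2) (l / 2)))"
    by (intro sums_mult poisson_rising_moment_sums)
  then have "(\<lambda>m. exp (- l / 2) * (l / 2) ^ m / fact m * pochhammer (r / 2 + real m) k * 2 ^ k
              * (1 - 2 * 0) powr (- (r / 2 + real m + real k)))
      sums (2 ^ k * poisson_rising_moment k (r / 2) (l / 2))"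
    by (simp add: exp_minus field_simps)
  from distributed_noncentral_chi_square_has_bochner_integral[OF V r l _ this] show ?thesis by simp
qed

text \<open>The tilt by \<open>e\<^bsup>tx\<^esup>\<close> divides the \<open>m\<close>-th term by \<open>(1 - 2t)\<^sup>m\<close>, so the Poisson sum becomes
  the exponential series at \<open>y = (l/2) / (1 - 2t)\<close>, and \<open>y - l/2 = l t / (1 - 2t)\<close>.\<close>

lemma noncentral_chi_square_mgf:
  fixes V :: "'a \<Rightarrow> real"
  assumes V: "distributed M lborel V (\<lambda>x. ennreal (noncentral_chi_square_density r l x))"
    and r: "r > 0" and l: "l \<ge> 0" and t: "t < 1 / 2"
  shows "has_bochner_integral M (\<lambda>\<omega>. exp (t * V \<omega>))
           ((1 - 2 * t) powr (- r / 2) * exp (l * t / (1 - 2 * t)))"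
proof -
  define d where "d = 1 - 2 * t"
  have pos: "d > 0" using t by (simp add: d_def)
  define y where "y = l / 2 / d"
  have "(\<lambda>m. exp (- l / 2) * d powr (- r / 2) * (y ^ m / fact m))
      sums (exp (- l / 2) * d powr (- r / 2) * exp y)"
    using exp_converges[of y] by (intro sums_mult) (simp add: divide_inverse mult.commute)
  moreover have "exp (- l / 2) * d powr (- r / 2) * exp y = d powr (- r / 2) * exp (l * t / d)"
  proof -
    have t_eq: "t = (1 - d) / 2" by (simp add: d_def)
    have "- l / 2 + y = l * t / d"
      unfolding t_eq y_def using pos by (simp add: field_simps)
    then have e: "exp (- l / 2) * exp y = exp (l * t / d)"
      by (simp only: exp_add[symmetric])
    have "exp (- l / 2) * d powr (- r / 2) * exp y = d powr (- r / 2) * (exp (- l / 2) * exp y)"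
      by (simp only: mult_ac)
    then show ?thesis by (simp only: e)
  qed
  moreover have "exp (- l / 2) * d powr (- r / 2) * (y ^ m / fact m)
      = exp (- l / 2) * (l / 2) ^ m / fact m * pochhammer (r / 2 + real m) 0 * 2 ^ 0
              * d powr (- (r / 2 + real m + real 0))" for m
  proof -
    have "- (r / 2 + real m) = - r / 2 - real m" by simp
    then have "d powr (- (r / 2 + real m)) = d powr (- r / 2) / d ^ m"
      using pos by (simp only: powr_diff powr_realpow)
    then show ?thesis by (simp add: y_def power_divide mult_ac)
  qed
  ultimately have "(\<lambda>m. exp (- l / 2) * (l / 2) ^ m / fact m * pochhammer (r / 2 + real m) 0 * 2 ^ 0
              * d powr (- (r / 2 + real m + real 0)))
      sums (d powr (- r / 2) * exp (l * t / d))"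
    by (simp only:)
  note this[unfolded d_def]
  from distributed_noncentral_chi_square_has_bochner_integral[OF V r l t this] show ?thesis by simp
qed

section \<open>Powers of a difference of independent variables\<close>

lemma (in prob_space) indep_var_mult_has_bochner_integral:
  fixes X Y :: "'a \<Rightarrow> real"
  assumes ind: "indep_var borel X borel Y"
    and f: "f \<in> borel_measurable borel" and g: "g \<in> borel_measurable borel"
    and X: "has_bochner_integral M (\<lambda>\<omega>. f (X \<omega>)) a"
    and Y: "has_bochner_integral M (\<lambda>\<omega>. g (Y \<omega>)) b"
  shows "has_bochner_integral M (\<lambda>\<omega>. f (X \<omega>) * g (Y \<omega>)) (a * b :: real)"
proof -
  have ind': "indep_var borel (\<lambda>\<omega>. f (X \<omega>)) borel (\<lambda>\<omega>. g (Y \<omega>))"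
    using indep_var_compose[OF ind f g] by (simp add: o_def)
  have "integrable M (\<lambda>\<omega>. f (X \<omega>))" "integrable M (\<lambda>\<omega>. g (Y \<omega>))"
    using X Y by (auto simp: has_bochner_integral_iff)
  from indep_var_integrable[OF ind' this] indep_var_lebesgue_integral[OF ind' this] X Y
  show ?thesis by (simp add: has_bochner_integral_iff)
qed

lemma (in prob_space) indep_var_diff_power_has_bochner_integral:
  fixes X Y :: "'a \<Rightarrow> real"
  assumes ind: "indep_var borel X borel Y"
    and X: "\<And>j. has_bochner_integral M (\<lambda>\<omega>. X \<omega> ^ j) (a j)"
    and Y: "\<And>j. has_bochner_integral M (\<lambda>\<omega>. Y \<omega> ^ j) (b j)"
  shows "has_bochner_integral M (\<lambda>\<omega>. (X \<omega> - Y \<omega>) ^ k)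
           (\<Sum>j=0..k. (-1) ^ (k - j) * real (k choose j) * a j * b (k - j))"
proof -
  have "(X \<omega> - Y \<omega>) ^ k
      = (\<Sum>j=0..k. (-1) ^ (k - j) * real (k choose j) * (X \<omega> ^ j * Y \<omega> ^ (k - j)))" for \<omega>
    using binomial_ring[of "X \<omega>" "- Y \<omega>" k]
    by (simp add: power_minus[of "Y \<omega>"] atLeast0AtMost mult_ac)
  moreover have "has_bochner_integral M
      (\<lambda>\<omega>. \<Sum>j=0..k. (-1) ^ (k - j) * real (k choose j) * (X \<omega> ^ j * Y \<omega> ^ (k - j)))
      (\<Sum>j=0..k. (-1) ^ (k - j) * real (k choose j) * (a j * b (k - j)))"
    by (intro has_bochner_integral_sum has_bochner_integral_mult_right
          indep_var_mult_has_bochner_integral[OF ind] X Y) auto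
  ultimately show ?thesis by (simp add: mult.assoc)
qed

lemma (in prob_space) diff_const_power_has_bochner_integral:
  fixes X :: "'a \<Rightarrow> real"
  assumes X: "\<And>j. has_bochner_integral M (\<lambda>\<omega>. X \<omega> ^ j) (a j)"
  shows "has_bochner_integral M (\<lambda>\<omega>. (X \<omega> - c) ^ k)
           (\<Sum>j=0..k. (-1) ^ (k - j) * real (k choose j) * a j * c ^ (k - j))"
proof -
  have "(X \<omega> - c) ^ k
      = (\<Sum>j=0..k. (-1) ^ (k - j) * real (k choose j) * c ^ (k - j) * X \<omega> ^ j)" for \<omega>
    using binomial_ring[of "X \<omega>" "- c" k]
    by (simp add: power_minus[of c] atLeast0AtMost mult_ac)
  moreover have "has_bochner_integral M
      (\<lambda>\<omega>. \<Sum>j=0..k. (-1) ^ (k - j) * real (k choose j) * c ^ (k - j) * X \<omega> ^ j)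
      (\<Sum>j=0..k. (-1) ^ (k - j) * real (k choose j) * c ^ (k - j) * a j)"
    by (intro has_bochner_integral_sum has_bochner_integral_mult_right X)
  ultimately show ?thesis by (simp add: mult_ac)
qed

section \<open>Derivatives of the cumulant generating function\<close>

text \<open>An iterated derivative at one point depends on the function near that point, so the induction
  has to run over all points of an open set at once.\<close>

lemma iterated_deriv_eq:
  fixes F :: "real \<Rightarrow> real"
  assumes S: "open S" and F: "\<And>t. t \<in> S \<Longrightarrow> F t = D 0 t"
    and D: "\<And>k t. t \<in> S \<Longrightarrow> (D k has_real_derivative D (Suc k) t) (at t)"
    and t: "t \<in> S"
  shows "(deriv ^^ k) F t = D k t"
  using t
proof (induction k arbitrary: t)
  case 0
  then show ?case using F by simp
next
  case (Suc k)
  have "((deriv ^^ k) F has_real_derivative D (Suc k) t) (at t)"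
    by (rule has_field_derivative_transform_within_open[OF D[OF Suc.prems] S Suc.prems])
       (simp add: Suc.IH)
  then show ?case by (simp add: DERIV_imp_deriv)
qed

text \<open>The \<open>k\<close>-th derivative of the logarithm of the moment generating function, in closed form.
  The shape for \<open>k > 0\<close> comes from \<open>t / (1 - 2t) = (1 / (1 - 2t) - 1) / 2\<close>.\<close>

definition noncentral_chi_square_cgf_deriv :: "real \<Rightarrow> real \<Rightarrow> nat \<Rightarrow> real \<Rightarrow> real" where
  "noncentral_chi_square_cgf_deriv r l k t =
     (case k of
        0 \<Rightarrow> - r / 2 * ln (1 - 2 * t) + l * t / (1 - 2 * t)
      | Suc n \<Rightarrow> 2 ^ n * fact n * (r / (1 - 2 * t) ^ Suc n + real (Suc n) * l / (1 - 2 * t) ^ Suc (Suc n)))"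

lemma has_real_derivative_noncentral_chi_square_cgf_deriv:
  assumes "t < 1 / 2"
  shows "(noncentral_chi_square_cgf_deriv r l k has_real_derivative
            noncentral_chi_square_cgf_deriv r l (Suc k) t) (at t)"
proof (cases k)
  case 0
  have "1 - 2 * t > 0" using assms by simp
  then show ?thesis unfolding noncentral_chi_square_cgf_deriv_def 0
    by (auto intro!: derivative_eq_intros simp: field_simps power2_eq_square)
next
  case (Suc n)
  have pos: "1 - 2 * t > 0" using assms by simp
  have inv: "((\<lambda>t. c / (1 - 2 * t) ^ Suc j) has_real_derivative
      2 * real (Suc j) * c / (1 - 2 * t) ^ Suc (Suc j)) (at t)" for j c
  proof -
    have "((\<lambda>t. c / (1 - 2 * t) ^ Suc j) has_real_derivative
       (0 * (1 - 2 * t) ^ Suc j - c * (real (Suc j) * (1 - 2 * t) ^ j * (- 2)))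
          / ((1 - 2 * t) ^ Suc j * (1 - 2 * t) ^ Suc j)) (at t)"
      using pos by (intro derivative_eq_intros | simp)+
    also have "(0 * (1 - 2 * t) ^ Suc j - c * (real (Suc j) * (1 - 2 * t) ^ j * (- 2)))
          / ((1 - 2 * t) ^ Suc j * (1 - 2 * t) ^ Suc j)
        = 2 * real (Suc j) * c / (1 - 2 * t) ^ Suc (Suc j)"
    proof -
      have "(0 * d ^ Suc j - c * (real (Suc j) * d ^ j * (- 2))) / (d ^ Suc j * d ^ Suc j)
          = 2 * real (Suc j) * c / d ^ Suc (Suc j)" if "d > 0" for d :: real
        using that by (simp add: field_simps del: of_nat_Suc)
      from this[OF pos] show ?thesis .
    qed
    finally show ?thesis .
  qed
  have "((\<lambda>t. 2 ^ n * fact n * (r / (1 - 2 * t) ^ Suc n + real (Suc n) * l / (1 - 2 * t) ^ Suc (Suc n)))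
     has_real_derivative 2 ^ n * fact n * (2 * real (Suc n) * r / (1 - 2 * t) ^ Suc (Suc n)
        + 2 * real (Suc (Suc n)) * (real (Suc n) * l) / (1 - 2 * t) ^ Suc (Suc (Suc n)))) (at t)"
    by (intro DERIV_cmult DERIV_add inv)
  also have "2 ^ n * fact n * (2 * real (Suc n) * r / (1 - 2 * t) ^ Suc (Suc n)
        + 2 * real (Suc (Suc n)) * (real (Suc n) * l) / (1 - 2 * t) ^ Suc (Suc (Suc n)))
      = 2 ^ Suc n * fact (Suc n) * (r / (1 - 2 * t) ^ Suc (Suc n)
        + real (Suc (Suc n)) * l / (1 - 2 * t) ^ Suc (Suc (Suc n)))"
    by (simp add: algebra_simps add_divide_distrib)
  finally show ?thesis unfolding noncentral_chi_square_cgf_deriv_def Suc by simp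
qed

lemma ln_noncentral_chi_square_mgf:
  assumes "t < 1 / 2"
  shows "ln ((1 - 2 * t) powr (- r / 2) * exp (l * t / (1 - 2 * t)))
           = noncentral_chi_square_cgf_deriv r l 0 t"
  using assms by (simp add: noncentral_chi_square_cgf_deriv_def ln_mult ln_powr)


section \<open>Moments of the difference of two noncentral chi-square variables\<close>

definition chi_square_diff_moment :: "real \<Rightarrow> real \<Rightarrow> real \<Rightarrow> nat \<Rightarrow> real" where
  "chi_square_diff_moment r l1 l2 k =
     (\<Sum>j=0..k. (-1) ^ (k - j) * real (k choose j)
        * (2 ^ j * poisson_rising_moment j (r / 2) (l1 / 2))
        * (2 ^ (k - j) * poisson_rising_moment (k - j) (r / 2) (l2 / 2)))"

lemma chi_square_diff_moment_conv_kummer_M: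
  assumes r: "r > 0"
  shows "chi_square_diff_moment r l1 l2 k =
           2 ^ k * exp (- (l1 + l2) / 2) / (Gamma (r / 2))\<^sup>2
           * (\<Sum>j=0..k. (- 1) ^ (k - j) * real (k choose j)
                * Gamma (real j + r / 2) * Gamma (real (k - j) + r / 2)
                * kummer_M (real j + r / 2) (r / 2) (l1 / 2)
                * kummer_M (real (k - j) + r / 2) (r / 2) (l2 / 2))"
  unfolding chi_square_diff_moment_def sum_distrib_left
proof (rule sum.cong[OF refl])
  fix j assume j: "j \<in> {0..k}"
  define G where "G = Gamma (r / 2)"
  define P1 where "P1 = poisson_rising_moment j (r / 2) (l1 / 2)"
  define P2 where "P2 = poisson_rising_moment (k - j) (r / 2) (l2 / 2)"
  define c where "c = (- 1) ^ (k - j) * real (k choose j)"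
  have G: "G > 0" using r by (simp add: G_def)
  have K1: "Gamma (real j + r / 2) * kummer_M (real j + r / 2) (r / 2) (l1 / 2) = G * exp (l1 / 2) * P1"
    and K2: "Gamma (real (k - j) + r / 2) * kummer_M (real (k - j) + r / 2) (r / 2) (l2 / 2)
        = G * exp (l2 / 2) * P2"
    unfolding G_def P1_def P2_def
    using r by (auto intro!: Gamma_kummer_M_conv_poisson_rising_moment)
  have e: "exp (- (l1 + l2) / 2) * exp (l1 / 2) * exp (l2 / 2) = 1"
    by (simp add: exp_add[symmetric] field_simps)
  have "2 ^ k * exp (- (l1 + l2) / 2) / G\<^sup>2
           * (c * Gamma (real j + r / 2) * Gamma (real (k - j) + r / 2)
                * kummer_M (real j + r / 2) (r / 2) (l1 / 2)
                * kummer_M (real (k - j) + r / 2) (r / 2) (l2 / 2))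
      = 2 ^ k * exp (- (l1 + l2) / 2) / G\<^sup>2
           * (c * (Gamma (real j + r / 2) * kummer_M (real j + r / 2) (r / 2) (l1 / 2))
                * (Gamma (real (k - j) + r / 2) * kummer_M (real (k - j) + r / 2) (r / 2) (l2 / 2)))"
    by (simp only: mult_ac)
  also have "\<dots> = (exp (- (l1 + l2) / 2) * exp (l1 / 2) * exp (l2 / 2)) * (2 ^ k * c * P1 * P2)"
    unfolding K1 K2 using G by (simp add: power2_eq_square)
  also have "\<dots> = 2 ^ k * c * P1 * P2" unfolding e by simp
  also have "\<dots> = c * (2 ^ j * P1) * (2 ^ (k - j) * P2)"
    using j by (simp add: power_add[symmetric])
  finally show "(- 1) ^ (k - j) * real (k choose j) * (2 ^ j * P1) * (2 ^ (k - j) * P2)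
      = 2 ^ k * exp (- (l1 + l2) / 2) / (Gamma (r / 2))\<^sup>2
           * ((- 1) ^ (k - j) * real (k choose j) * Gamma (real j + r / 2) * Gamma (real (k - j) + r / 2)
                * kummer_M (real j + r / 2) (r / 2) (l1 / 2)
                * kummer_M (real (k - j) + r / 2) (r / 2) (l2 / 2))"
    by (simp only: G_def c_def)
qed

lemma chi_square_diff_moment_0: "chi_square_diff_moment r l1 l2 0 = 1"
  by (simp add: chi_square_diff_moment_def)

lemma chi_square_diff_moment_1: "chi_square_diff_moment r l1 l2 1 = l1 - l2"
  by (simp add: chi_square_diff_moment_def)

lemma chi_square_diff_moment_2:
  "chi_square_diff_moment r l1 l2 2 = 4 * (r + l1 + l2) + (l1 - l2)\<^sup>2"
  by (simp add: chi_square_diff_moment_def eval_nat_numeral) (simp add: field_simps)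

lemma chi_square_diff_moment_3:
  "chi_square_diff_moment r l1 l2 3 = 12 * (l1 - l2) * (r + l1 + l2 + 2) + (l1 - l2) ^ 3"
  by (simp add: chi_square_diff_moment_def eval_nat_numeral) (simp add: field_simps)

lemma chi_square_diff_moment_4:
  "chi_square_diff_moment r l1 l2 4 = 48 * (r + l1 + l2)\<^sup>2 + 96 * (r + 2 * l1 + 2 * l2)
     + 24 * (l1 - l2)\<^sup>2 * (r + l1 + l2 + 4) + (l1 - l2) ^ 4"
  by (simp add: chi_square_diff_moment_def eval_nat_numeral) (simp add: field_simps)

section \<open>Moments, shape parameters and cumulants of the difference\<close>

theorem proposition2p8:
  fixes M :: "'a measure" and V1 V2 T :: "'a \<Rightarrow> real" and r l1 l2 :: real
  assumes "prob_space M"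
    and "r > 0" and "l1 \<ge> 0" and "l2 \<ge> 0"
    and "distributed M lborel V1 (\<lambda>x. ennreal (noncentral_chi_square_density r l1 x))"
    and "distributed M lborel V2 (\<lambda>x. ennreal (noncentral_chi_square_density r l2 x))"
    and "prob_space.indep_var M borel V1 borel V2"
    and T_def: "T = (\<lambda>\<omega>. V1 \<omega> - V2 \<omega>)"
  shows "(\<forall>k\<ge>1. integrable M (\<lambda>\<omega>. T \<omega> ^ k)
            \<and> raw_moment M T k =
                2 ^ k * exp (- (l1 + l2) / 2) / (Gamma (r / 2))\<^sup>2
                * (\<Sum>j=0..k. (- 1) ^ (k - j) * real (k choose j)
                     * Gamma (real j + r / 2) * Gamma (real (k - j) + r / 2)
                     * kummer_M (real j + r / 2) (r / 2) (l1 / 2)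
                     * kummer_M (real (k - j) + r / 2) (r / 2) (l2 / 2)))
    \<and> raw_moment M T 1 = l1 - l2
    \<and> raw_moment M T 2 = 4 * (r + l1 + l2) + (l1 - l2)\<^sup>2
    \<and> raw_moment M T 3 = 12 * (l1 - l2) * (r + l1 + l2 + 2) + (l1 - l2) ^ 3
    \<and> raw_moment M T 4 = 48 * (r + l1 + l2)\<^sup>2 + 96 * (r + 2 * l1 + 2 * l2)
           + 24 * (l1 - l2)\<^sup>2 * (r + l1 + l2 + 4) + (l1 - l2) ^ 4
    \<and> central_moment M T 2 = 4 * (r + l1 + l2)
    \<and> central_moment M T 3 = 24 * (l1 - l2)
    \<and> central_moment M T 4 = 48 * (r + l1 + l2)\<^sup>2 + 96 * (r + 2 * l1 + 2 * l2)
    \<and> prob_space.variance M T = 4 * (r + l1 + l2)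
    \<and> skewness M T = 3 * (l1 - l2) / (r + l1 + l2) powr (3 / 2)
    \<and> excess_kurtosis M T = 6 * (r + 2 * l1 + 2 * l2) / (r + l1 + l2)\<^sup>2
    \<and> (\<forall>\<^sub>F t in nhds 0. integrable M (\<lambda>\<omega>. exp (t * T \<omega>)))
    \<and> (\<forall>k\<ge>1. cumulant M T k =
            2 ^ (k - 1) * fact (k - 1) * ((r + real k * l1) + (- 1) ^ k * (r + real k * l2)))"
proof -
  interpret prob_space M by fact
  note r = \<open>r > 0\<close> and l1 = \<open>l1 \<ge> 0\<close> and l2 = \<open>l2 \<ge> 0\<close>
  note V1 = assms(5) and V2 = assms(6) and ind = assms(7)
  define m where "m = chi_square_diff_moment r l1 l2"
  define s where "s = r + l1 + l2"
  have s: "s > 0" using r l1 l2 by (simp add: s_def)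
  have T: "has_bochner_integral M (\<lambda>\<omega>. T \<omega> ^ k) (m k)" for k
    unfolding T_def m_def chi_square_diff_moment_def
    by (intro indep_var_diff_power_has_bochner_integral ind noncentral_chi_square_moment V1 V2 r l1 l2)
  have raw: "raw_moment M T k = m k" for k
    using T[of k] by (simp add: raw_moment_def has_bochner_integral_iff)
  have ET: "expectation T = l1 - l2"
    using raw[of 1] by (simp add: raw_moment_def m_def chi_square_diff_moment_1[unfolded One_nat_def])
  have central: "central_moment M T k
      = (\<Sum>j=0..k. (-1) ^ (k - j) * real (k choose j) * m j * (l1 - l2) ^ (k - j))" for k
    using diff_const_power_has_bochner_integral[OF T, of "l1 - l2" k]
    by (simp add: central_moment_def ET has_bochner_integral_iff)
  note m_eqs = chi_square_diff_moment_0 chi_square_diff_moment_1[unfolded One_nat_def]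
    chi_square_diff_moment_2[unfolded numeral_2_eq_2] chi_square_diff_moment_3[unfolded numeral_3_eq_3]
  \<comment> \<open>The sums below are unrolled by writing their bounds with \<open>Suc\<close>, so the moments are needed
    in that notation.\<close>
  have "chi_square_diff_moment r l1 l2 (Suc (Suc (Suc (Suc 0)))) = 48 * (r + l1 + l2)\<^sup>2
      + 96 * (r + 2 * l1 + 2 * l2) + 24 * (l1 - l2)\<^sup>2 * (r + l1 + l2 + 4) + (l1 - l2) ^ 4"
    using chi_square_diff_moment_4 by (simp only: eval_nat_numeral BitM.simps pred_numeral_simps)
  note m_eqs = m_eqs this
  have c2: "central_moment M T 2 = 4 * (r + l1 + l2)"
    unfolding central m_def by (simp add: eval_nat_numeral m_eqs) (simp add: algebra_simps)
  have c3: "central_moment M T 3 = 24 * (l1 - l2)"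
    unfolding central m_def by (simp add: eval_nat_numeral m_eqs) (simp add: algebra_simps)
  have c4: "central_moment M T 4 = 48 * (r + l1 + l2)\<^sup>2 + 96 * (r + 2 * l1 + 2 * l2)"
    unfolding central m_def by (simp add: eval_nat_numeral m_eqs) (simp add: algebra_simps)
  have var: "variance T = 4 * (r + l1 + l2)"
    using c2 by (simp add: central_moment_def)
  have skew: "skewness M T = 3 * (l1 - l2) / (r + l1 + l2) powr (3 / 2)"
  proof -
    have "sqrt (4 * s) ^ 3 = 8 * s powr (3 / 2)"
    proof -
      have "sqrt (4 * s) ^ 3 = 2 ^ 3 * (sqrt s) ^ 3"
        by (simp add: real_sqrt_mult power_mult_distrib)
      also have "sqrt s ^ 3 = s powr (3 / 2)"
        using s by (simp add: powr_half_sqrt[symmetric] powr_power)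
      finally show ?thesis by simp
    qed
    moreover have "24 * d / (8 * p) = 3 * d / p" for d p :: real by simp
    ultimately show ?thesis
      unfolding skewness_def c3 var s_def[symmetric] by (simp only:)
  qed
  have kurt: "excess_kurtosis M T = 6 * (r + 2 * l1 + 2 * l2) / (r + l1 + l2)\<^sup>2"
  proof -
    have "sqrt (4 * s) ^ 4 = 16 * s\<^sup>2"
      using s power_mult[of "sqrt (4 * s)" 2 2] by (simp add: power_mult_distrib)
    then show ?thesis
      unfolding excess_kurtosis_def c4 var s_def[symmetric] using s by (simp add: field_simps)
  qed

  define S :: "real set" where "S = {-1/2<..<1/2}"
  have S: "open S" "0 \<in> S" by (auto simp: S_def)
  define u where "u = (\<lambda>l t. (1 - 2 * t) powr (- r / 2) * exp (l * t / (1 - 2 * t)))"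
  have mgf: "has_bochner_integral M (\<lambda>\<omega>. exp (t * T \<omega>)) (u l1 t * u l2 (- t))" if t: "t \<in> S" for t
  proof -
    have "has_bochner_integral M (\<lambda>\<omega>. exp (t * V1 \<omega>) * exp (- t * V2 \<omega>)) (u l1 t * u l2 (- t))"
      unfolding u_def using t
      by (intro indep_var_mult_has_bochner_integral[OF ind] noncentral_chi_square_mgf V1 V2 r l1 l2)
         (auto simp: S_def)
    then show ?thesis by (simp add: T_def exp_add[symmetric] algebra_simps)
  qed
  have ev: "\<forall>\<^sub>F t in nhds 0. integrable M (\<lambda>\<omega>. exp (t * T \<omega>))"
    using eventually_nhds_in_open[OF S] by eventually_elim (use mgf in \<open>auto simp: has_bochner_integral_iff\<close>)

  \<comment> \<open>The sign \<open>(-1)\<^sup>k\<close> is the inner derivative of \<open>t \<mapsto> -t\<close>, once for each differentiation.\<close>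
  define D where "D = (\<lambda>k t. noncentral_chi_square_cgf_deriv r l1 k t
      + (-1) ^ k * noncentral_chi_square_cgf_deriv r l2 k (- t))"
  have cum: "cumulant M T k = D k 0" for k
    unfolding cumulant_def
  proof (rule iterated_deriv_eq[where S = S])
    fix t assume t: "t \<in> S"
    have "u l1 t > 0" "u l2 (- t) > 0" using t by (auto simp: u_def S_def)
    then have "ln (u l1 t * u l2 (- t)) = ln (u l1 t) + ln (u l2 (- t))"
      by (rule ln_mult_pos)
    then show "ln (integral\<^sup>L M (\<lambda>\<omega>. exp (t * T \<omega>))) = D 0 t"
      using mgf[OF t] t ln_noncentral_chi_square_mgf[of t r l1] ln_noncentral_chi_square_mgf[of "- t" r l2]
      by (simp add: has_bochner_integral_iff D_def u_def S_def)
  next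
    fix k t assume t: "t \<in> S"
    have 1: "(noncentral_chi_square_cgf_deriv r l1 k has_real_derivative
        noncentral_chi_square_cgf_deriv r l1 (Suc k) t) (at t)"
      using t by (intro has_real_derivative_noncentral_chi_square_cgf_deriv) (simp add: S_def)
    have 2: "((\<lambda>t. noncentral_chi_square_cgf_deriv r l2 k (- t)) has_real_derivative
        noncentral_chi_square_cgf_deriv r l2 (Suc k) (- t) * (- 1)) (at t)"
      using t
      by (intro DERIV_chain2[OF has_real_derivative_noncentral_chi_square_cgf_deriv])
         (auto simp: S_def intro!: derivative_eq_intros)
    show "(D k has_real_derivative D (Suc k) t) (at t)"
      using DERIV_add[OF 1 DERIV_cmult[OF 2, of "(-1) ^ k"]] by (simp add: D_def)
  qed (use S in auto)
  have cum': "cumulant M T k =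
      2 ^ (k - 1) * fact (k - 1) * ((r + real k * l1) + (- 1) ^ k * (r + real k * l2))" if "k \<ge> 1" for k
  proof -
    from that obtain n where n: "k = Suc n" by (cases k) auto
    show ?thesis
      by (simp add: cum D_def n noncentral_chi_square_cgf_deriv_def algebra_simps)
  qed
  have raw_kummer: "integrable M (\<lambda>\<omega>. T \<omega> ^ k) \<and> raw_moment M T k =
                2 ^ k * exp (- (l1 + l2) / 2) / (Gamma (r / 2))\<^sup>2
                * (\<Sum>j=0..k. (- 1) ^ (k - j) * real (k choose j)
                     * Gamma (real j + r / 2) * Gamma (real (k - j) + r / 2)
                     * kummer_M (real j + r / 2) (r / 2) (l1 / 2)
                     * kummer_M (real (k - j) + r / 2) (r / 2) (l2 / 2))" for k
    using T[of k] unfolding raw m_def chi_square_diff_moment_conv_kummer_M[OF r]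
    by (simp only: has_bochner_integral_iff)
  show ?thesis
    by (intro conjI allI impI raw_kummer c2 c3 c4 var skew kurt ev cum'
          raw[of 1, unfolded m_def chi_square_diff_moment_1] raw[of 2, unfolded m_def chi_square_diff_moment_2]
          raw[of 3, unfolded m_def chi_square_diff_moment_3] raw[of 4, unfolded m_def chi_square_diff_moment_4])
       (auto simp: raw_kummer)
qed

end
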